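(* There is a one-to-one correspondence between (a) the set of all matched pairs of skeletal $L_\infty$-algebras, and (b) the set of triples $\big( (\mathfrak{g}, \mathfrak{h}, \rho, \psi) , (V, W, \alpha, \beta ), (F_1, 0, F_3) \big)$, where $(\mathfrak{g}, \mathfrak{h}, \rho, \psi)$ is a matched pair of Lie algebras, $(V, W, \alpha, \beta)$ is a representation of it, and $(F_1, 0, F_3)\in C^3(\mathfrak{g},\mathfrak{h};V,W)$ is a $3$-cocycle, i.e. $\delta_\mathrm{MPL}((F_1,0,F_3))=0$.
   Context: All vector spaces and (multi)linear maps are over a field $\mathbf{k}$ of characteristic zero. **Skeletal $L_\infty$-algebras.** A skeletal $L_\infty$-algebra $(\mathfrak{g}_1\xrightarrow{0}\mathfrak{g}_0,[~,~]_\mathcal{G},\mu_3)$ consists of vector spaces $\mathfrak{g}_0,\mathfrak{g}_1$, a skew-symmetric bilinear map $[~,~]_\mathcal{G}:\mathfrak{g}_i\times\mathfrak{g}_j\to\mathfrak{g}_{i+j}$ ($0\le i,j,i+j\le1$) and a skew-symmetric trilinear map $\mu_3:\mathfrak{g}_0\times\mathfrak{g}_0\times\mathfrak{g}_0\to\mathfrak{g}_1$ with, for $x,y,z,z'\in\mathfrak{g}_0$, $v\in\mathfrak{g}_1$: $[x,[y,z]_\mathcal{G}]_\mathcal{G}+[y,[z,x]_\mathcal{G}]_\mathcal{G}+[z,[x,y]_\mathcal{G}]_\mathcal{G}=0$; $[x,[y,v]_\mathcal{G}]_\mathcal{G}+[y,[v,x]_\mathcal{G}]_\mathcal{G}+[v,[x,y]_\mathcal{G}]_\mathcal{G}=0$;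 and $$[x, \mu_3 (y, z, z')]_\mathcal{G} - [y, \mu_3 (x, z, z')]_\mathcal{G} + [z, \mu_3 (x, y, z')]_\mathcal{G} - [z' , \mu_3 (x, y, z)]_\mathcal{G} = \mu_3 ([x, y]_\mathcal{G}, z, z') - \mu_3 ([x, z]_\mathcal{G}, y, z')$$ $$+ \mu_3 ([x, z']_\mathcal{G}, y, z) + \mu_3 ([y, z]_\mathcal{G}, x, z') - \mu_3 ([y, z']_\mathcal{G}, x, z) + \mu_3 ([z, z']_\mathcal{G}, x, y).$$ A representation of it is $(V_1\xrightarrow{0}V_0,\rho_2,\rho_3)$ with vector spaces $V_0,V_1$, a bilinear map $\rho_2:\mathfrak{g}_i\times V_j\to V_{i+j}$ ($0\le i,j,i+j\le1$) and a trilinear map $\rho_3:\mathfrak{g}_0\times\mathfrak{g}_0\times V_0\to V_1$ such that, for $x,y,z\in\mathfrak{g}_0$, $v\in V_0$, and $u\in V_0$ or $u\in V_1$: $\rho_3(x,y,v)=-\rho_3(y,x,v)$; $\rho_2(x,\rho_2(y,u))-\rho_2(y,\rho_2(x,u))-\rho_2([x,y]_\mathcal{G},u)=0$; and $$\rho_2 (x, \rho_3 (y, z, v) ) - \rho_2 (y, \rho_3 (x, z, v)) + \rho_2 (z, \rho_3 (x, y, v)) + \rho_2 (\mu_3 (x, y, z), v) = \rho_3 ([x, y]_\mathcal{G}, z, v) - \rho_3 ([x, z]_\mathcal{G}, y, v)$$ $$+ \rho_3 (y, z, \rho_2 (x, v)) + \rho_3 ([y, z]_\mathcal{G}, x, v)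 - \rho_3 (x, z, \rho_2 (y, v)) + \rho_3 (x, y, \rho_2 (z, v)).$$ A matched pair of skeletal $L_\infty$-algebras is a tuple $((\mathfrak{g}_1\xrightarrow{0}\mathfrak{g}_0,[~,~]_\mathcal{G},\mu_3),(\mathfrak{h}_1\xrightarrow{0}\mathfrak{h}_0,[~,~]_\mathcal{H},\nu_3),\rho_2,\rho_3,\psi_2,\psi_3)$ in which the first two entries are skeletal $L_\infty$-algebras $\mathcal{G},\mathcal{H}$; $\rho_2:\mathfrak{g}_i\times\mathfrak{h}_j\to\mathfrak{h}_{i+j}$, $\rho_3:\mathfrak{g}_0\times\mathfrak{g}_0\times\mathfrak{h}_0\to\mathfrak{h}_1$ make $\mathfrak{h}_1\xrightarrow{0}\mathfrak{h}_0$ a representation of $\mathcal{G}$; $\psi_2:\mathfrak{h}_i\times\mathfrak{g}_j\to\mathfrak{g}_{i+j}$, $\psi_3:\mathfrak{h}_0\times\mathfrak{h}_0\times\mathfrak{g}_0\to\mathfrak{g}_1$ make $\mathfrak{g}_1\xrightarrow{0}\mathfrak{g}_0$ a representation of $\mathcal{H}$; and for $x,y,z\in\mathfrak{g}_0$, $v\in\mathfrak{g}_1$, $h,k,k'\in\mathfrak{h}_0$, $w\in\mathfrak{h}_1$: $$\rho_2 ( [x, v]_\mathcal{G} ,h) = \rho_2 (x, \rho_2 (v, h)) - \rho_2 (v, \rho_2 (x, h)),\quad \psi_2 ([h, w]_\mathcal{H}, x) = \psi_2 (h, \psi_2 (w, x)) - \psi_2 (w, \psi_2 (h, x)),$$ $$\rho_2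 (x, [h, w]_\mathcal{H}) = [\rho_2 (x, h), w]_\mathcal{H} + [h, \rho_2 (x, w)]_\mathcal{H} + \rho_2 (\psi_2 (w, x), h) - \rho_2 (\psi_2 (h, x), w),$$ $$\rho_2 (v, [h, k]_\mathcal{H}) = [\rho_2 (v, h), k]_\mathcal{H} + [h, \rho_2 (v, k)]_\mathcal{H} + \rho_2 (\psi_2 (k, v), h) - \rho_2 (\psi_2 (h, v), k),$$ $$\psi_2 (h, [x, v]_\mathcal{G}) = [\psi_2 (h, x), v]_\mathcal{G} + [x, \psi_2 (h, v)]_\mathcal{G} + \psi_2 (\rho_2 (v, h), x) - \psi_2 (\rho_2 (x, h), v),$$ $$\psi_2 (w, [x, y]_\mathcal{G}) = [\psi_2 (w, x), y]_\mathcal{G} + [x, \psi_2 (w, y)]_\mathcal{G} + \psi_2 (\rho_2 (y, w), x) - \psi_2 (\rho_2 (x, w), y),$$ $$[x, \psi_3 (h, k, y)]_\mathcal{G} - [y, \psi_3 (h, k, x)]_\mathcal{G} - \psi_3 (h, k, [x, y]_\mathcal{G} ) - \psi_3 (\rho_2 (x, h), k, y) + \psi_3 (\rho_2 (x, k), h, y) + \psi_3 (\rho_2 (y, h), k, x) - \psi_3 (\rho_2 (y, k), h, x) = 0,$$ $$\rho_2 (x, \nu_3 (h, k, k')) + \rho_2 ( \psi_3 (k, k', x), h) - \rho_2 (\psi_3 (h, k', x), k) + \rho_2 ( \psi_3 (h, k, x), k') - \nu_3 (\rho_2 (x, h), k, k') + \nu_3 (\rho_2 (x, k), h, k') - \nu_3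 (\rho_2 (x, k'), h, k) = 0,$$ $$[h, \rho_3 (x, y, k)]_\mathcal{H} - [k, \rho_3 (x, y, h)]_\mathcal{H} - \rho_3 (x, y, [h, k]_\mathcal{H} ) - \rho_3 (\psi_2 (h, x), y, k) + \rho_3 (\psi_2 (h, y), x, k) + \rho_3 (\psi_2 (k, x), y, h) - \rho_3 (\psi_2 (k, y), x, h) = 0,$$ $$\psi_2 (h, \mu_3 (x, y, z)) + \psi_2 ( \rho_3 (y, z, h), x) - \psi_2 (\rho_3 (x, z, h), y) + \psi_2 ( \rho_3 (x, y, h), z) - \mu_3 (\psi_2 (h, x), y, z) + \mu_3 (\psi_2 (h, y), x, z) - \mu_3 (\psi_2 (h, z), x, y) = 0.$$ **Matched pairs of Lie algebras and representations.** A matched pair of Lie algebras is $(\mathfrak{g}, \mathfrak{h}, \rho, \psi)$ with $\mathfrak{g},\mathfrak{h}$ Lie algebras, $\rho : \mathfrak{g} \times \mathfrak{h} \to \mathfrak{h}$ a representation of $\mathfrak{g}$ on $\mathfrak{h}$, $\psi : \mathfrak{h} \times \mathfrak{g} \to \mathfrak{g}$ a representation of $\mathfrak{h}$ on $\mathfrak{g}$, and $\rho_x ([h, k]_\mathfrak{h}) = [\rho_x h , k]_\mathfrak{h} + [h, \rho_x k]_\mathfrak{h} + \rho_{\psi_k x} h - \rho_{\psi_h x} k$, $\psi_h ([x, y]_\mathfrak{g}) = [\psi_h x , y]_\mathfrak{g} + [x, \psi_h y]_\mathfrak{g} + \psi_{\rho_y h} x - \psi_{\rho_x h} y$. Write $\mu,\nu$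 for the brackets of $\mathfrak{g},\mathfrak{h}$. A representation of it is $(V,W,\alpha,\beta)$ in which $V$ and $W$ are each representations of both $\mathfrak{g}$ (actions $\rho_V,\rho_W$) and $\mathfrak{h}$ (actions $\psi_V,\psi_W$), and $\alpha: V \times \mathfrak{h} \to W$, $\beta: W \times \mathfrak{g} \to V$ are bilinear with $$\alpha_{ (\rho_V)_x v} h = (\rho_W)_x \alpha_v h - \alpha_v \rho_x h,\qquad \beta_{ (\psi_W)_h w} x = (\psi_V)_h \beta_w x - \beta_w \psi_h x,$$ $$(\rho_W)_x (\psi_W)_h w = (\psi_W)_{\rho_x h} w + (\psi_W)_h (\rho_W)_x w + \alpha_{\beta_w x} h - (\rho_W)_{\psi_h x} w,$$ $$\alpha_v [h, k]_\mathfrak{h} = - (\psi_W)_k \alpha_v h + (\psi_W)_h \alpha_v k + \alpha_{ (\psi_V)_k v} h - \alpha_{ (\psi_V)_h v} k,$$ $$(\psi_V)_h (\rho_V)_x v = (\rho_V)_{\psi_h x} v + (\rho_V)_x (\psi_V)_h v + \beta_{\alpha_v h} x - (\psi_V)_{\rho_x h} v,$$ $$\beta_w [x, y]_\mathfrak{g} = - (\rho_V)_y \beta_w x + (\rho_V)_x \beta_w y + \beta_{ (\rho_W)_y w} x - \beta_{ (\rho_W)_x w } y.$$ **Cochains.** For $k,l\ge0$, $C^{k|l}(\mathfrak{g},\mathfrak{h};V,W)=\mathrm{Hom}(\wedge^{k+1}\mathfrak{g}\otimes\wedge^l\mathfrak{h},V)\oplus\mathrm{Hom}(\wedge^k\mathfrak{g}\otimes\wedge^{l+1}\mathfrak{h},W)$;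 for $n\ge1$, $C^n(\mathfrak{g},\mathfrak{h};V,W)=C^{n-1|0}(\mathfrak{g},\mathfrak{h};V,W)\oplus\cdots\oplus C^{0|n-1}(\mathfrak{g},\mathfrak{h};V,W)$, with elements $(F_1,\ldots,F_n)$, $F_r\in C^{n-r|r-1}(\mathfrak{g},\mathfrak{h};V,W)$; in particular $C^3=C^{2|0}\oplus C^{1|1}\oplus C^{0|2}$. The coboundary $\delta_\mathrm{MPL}:C^n(\mathfrak{g},\mathfrak{h};V,W)\to C^{n+1}(\mathfrak{g},\mathfrak{h};V,W)$ ($n\ge1$) is $$\delta_\mathrm{MPL} ((F_1, \ldots, F_n )) = \big( \delta^{\mu \ltimes \rho} (F_1), \ldots, \delta^{\mu \ltimes \rho} (F_r) + \delta^{\psi \rtimes \nu} (F_{r-1}), \ldots, \delta^{\psi \rtimes \nu} (F_n) \big),$$ where the $r$-th entry lies in $C^{n-r+1|r-1}(\mathfrak{g},\mathfrak{h};V,W)$ and, for $F_r\in C^{n-r|r-1}(\mathfrak{g},\mathfrak{h};V,W)$, $x_i\in\mathfrak{g}$, $h_i\in\mathfrak{h}$ (with $\alpha(v,h)=\alpha_vh$, $\beta(w,x)=\beta_wx$, and in mixed terms $\rho_{x_i}h_j$ standing in the place of $h_j$, $\psi_{h_j}x_i$ in the place of $x_i$): $$\delta^{\mu \ltimes \rho} (F_r)(x_1, \ldots, x_{n-r+2}, h_1, \ldots, h_{r-1}) = \sum_{i=1}^{n-r+2} (-1)^{i+1} (\rho_V)_{x_i} F_r (x_1, \ldots, \widehat{x_i},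 \ldots, x_{n-r+2}, h_1, \ldots, h_{r-1})$$ $$+ \sum_{1 \leq i < j \leq n-r+2} (-1)^{i+j} F_r ([x_i , x_j]_\mathfrak{g}, x_1, \ldots, \widehat{x_i}, \ldots, \widehat{x_j}, \ldots, x_{n-r+2}, h_1, \ldots, h_{r-1})$$ $$+ \sum_{1 \leq i \leq n-r+2,\ 1 \leq j \leq r-1} (-1)^{n-r+i} F_r (x_1, \ldots, \widehat{x_i}, \ldots, x_{n-r+2}, h_1, \ldots, \rho_{x_i} h_j , \ldots, h_{r-1}),$$ $$\delta^{\mu \ltimes \rho} (F_r)(x_1, \ldots, x_{n-r+1}, h_1, \ldots, h_{r}) = \sum_{i=1}^{n-r+1} (-1)^{i+1} (\rho_W)_{x_i} F_r (x_1, \ldots, \widehat{x_i}, \ldots, x_{n-r+1}, h_1, \ldots, h_{r})$$ $$+ \sum_{i=1}^r (-1)^{n-r+i+1} \alpha \big( F_r (x_1, \ldots, x_{n-r+1}, h_1, \ldots, \widehat{h_i}, \ldots, h_r), h_i \big)$$ $$+ \sum_{1 \leq i < j \leq n-r+1} (-1)^{i+j} F_r ([x_i , x_j]_\mathfrak{g}, x_1, \ldots, \widehat{x_i}, \ldots, \widehat{x_j}, \ldots, x_{n-r+1}, h_1, \ldots, h_{r})$$ $$+ \sum_{1 \leq i \leq n-r+1,\ 1 \leq j \leq r} (-1)^{n-r+i+1} F_r (x_1, \ldots, \widehat{x_i}, \ldots, x_{n-r+1}, h_1, \ldots, \rho_{x_i} h_j , \ldots, h_{r}),$$ $$\delta^{\psi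 \rtimes \nu} (F_r)(x_1, \ldots, x_{n-r+1}, h_1,\ldots, h_{r}) = \sum_{i=1}^{n-r+1} (-1)^i \beta \big( F_r (x_1, \ldots, \widehat{x_i}, \ldots, x_{n-r+1}, h_1, \ldots, h_r), x_i \big)$$ $$+ \sum_{i=1}^r (-1)^{n-r+i} (\psi_V)_{h_i} F_r (x_1, \ldots, x_{n-r+1}, h_1, \ldots, \widehat{h_i}, \ldots, h_r)$$ $$+ \sum_{1 \leq i \leq n-r+1,\ 1 \leq j \leq r} (-1)^{n-r+j} F_r (x_1, \ldots, \psi_{h_j} x_i, \ldots, x_{n-r+1}, h_1, \ldots, \widehat{h_j}, \ldots, h_r)$$ $$+ \sum_{1 \leq j < k \leq r} (-1)^{n-r+1 + j+ k} F_r (x_1, \ldots, x_{n-r+1}, [h_j , h_k]_\mathfrak{h}, h_1, \ldots, \widehat{h_j}, \ldots, \widehat{h_k}, \ldots, h_r),$$ $$\delta^{\psi \rtimes \nu} (F_r)(x_1, \ldots, x_{n-r}, h_1,\ldots, h_{r+1}) = \sum_{i=1}^{r+1} (-1)^{n-r+i +1} (\psi_W)_{h_i} F_r (x_1, \ldots, x_{n-r}, h_1, \ldots, \widehat{h_i}, \ldots, h_{r+1})$$ $$+ \sum_{1 \leq i \leq n-r,\ 1 \leq j \leq r+1} (-1)^{n-r+j+1} F_r (x_1, \ldots, \psi_{h_j} x_i, \ldots , x_{n-r}, h_1, \ldots, \widehat{h_j}, \ldots, h_{r+1})$$ $$+ \sum_{1 \leq j < k \leq r+1} (-1)^{n-r+j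 + k} F_r (x_1, \ldots, x_{n-r}, [h_j, h_k]_\mathfrak{h}, h_1, \ldots, \widehat{h_j}, \ldots, \widehat{h_k}, \ldots, h_{r+1}).$$
   Formalization: Two corrections: matched pairs of skeletal L∞-algebras also satisfy the degree-0 compatibilities for ρ2(x,[h,k]) and ψ2(h,[x,y]); and the mixed terms of δ_MPL carry signs (-1)^i (ρ-terms) and (-1)^{n-r+1+j}, (-1)^{n-r+j} (ψ-terms), since the claim fails with the printed ones. *)

theory Defs
  imports Complex_Main "HOL-Library.Function_Algebras" "HOL-Library.Product_Plus"
begin

section \<open>Multilinear maps\<close>

text \<open>Vector spaces over a field are given, as in the library, by an abelian group type and a
  scalar multiplication satisfying \<^locale>\<open>vector_space\<close>.\<close>

definition bilin ::
  "('k::field \<Rightarrow> 'a::ab_group_add \<Rightarrow> 'a) \<Rightarrow> ('k \<Rightarrow> 'b::ab_group_add \<Rightarrow> 'b) \<Rightarrow>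
   ('k \<Rightarrow> 'c::ab_group_add \<Rightarrow> 'c) \<Rightarrow> ('a \<Rightarrow> 'b \<Rightarrow> 'c) \<Rightarrow> bool" where
  "bilin sA sB sC f \<longleftrightarrow>
     (\<forall>y. Vector_Spaces.linear sA sC (\<lambda>x. f x y)) \<and>
     (\<forall>x. Vector_Spaces.linear sB sC (\<lambda>y. f x y))"

definition trilin ::
  "('k::field \<Rightarrow> 'a::ab_group_add \<Rightarrow> 'a) \<Rightarrow> ('k \<Rightarrow> 'b::ab_group_add \<Rightarrow> 'b) \<Rightarrow>
   ('k \<Rightarrow> 'c::ab_group_add \<Rightarrow> 'c) \<Rightarrow> ('k \<Rightarrow> 'd::ab_group_add \<Rightarrow> 'd) \<Rightarrow>
   ('a \<Rightarrow> 'b \<Rightarrow> 'c \<Rightarrow> 'd) \<Rightarrow> bool" where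
  "trilin sA sB sC sD f \<longleftrightarrow>
     (\<forall>y z. Vector_Spaces.linear sA sD (\<lambda>x. f x y z)) \<and>
     (\<forall>x z. Vector_Spaces.linear sB sD (\<lambda>y. f x y z)) \<and>
     (\<forall>x y. Vector_Spaces.linear sC sD (\<lambda>z. f x y z))"


section \<open>Skeletal L-infinity algebras, representations, matched pairs\<close>

text \<open>The bracket of degree 0 on a graded space concentrated in degrees 0 and 1 has the three
  components \<open>br00\<close>, \<open>br01\<close>, \<open>br10\<close>; likewise for the binary part of a representation.\<close>

record ('a, 'b) skel_Linf =
  br00 :: "'a \<Rightarrow> 'a \<Rightarrow> 'a"
  br01 :: "'a \<Rightarrow> 'b \<Rightarrow> 'b"
  br10 :: "'b \<Rightarrow> 'a \<Rightarrow> 'b"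
  br3  :: "'a \<Rightarrow> 'a \<Rightarrow> 'a \<Rightarrow> 'b"

record ('a, 'b, 'c, 'd) skel_act =
  act00 :: "'a \<Rightarrow> 'c \<Rightarrow> 'c"
  act01 :: "'a \<Rightarrow> 'd \<Rightarrow> 'd"
  act10 :: "'b \<Rightarrow> 'c \<Rightarrow> 'd"
  act3  :: "'a \<Rightarrow> 'a \<Rightarrow> 'c \<Rightarrow> 'd"

definition skeletal_Linf ::
  "('k::field \<Rightarrow> 'a::ab_group_add \<Rightarrow> 'a) \<Rightarrow> ('k \<Rightarrow> 'b::ab_group_add \<Rightarrow> 'b) \<Rightarrow>
   ('a, 'b) skel_Linf \<Rightarrow> bool" where
  "skeletal_Linf s0 s1 G \<longleftrightarrow>
     bilin s0 s0 s0 (br00 G) \<and> bilin s0 s1 s1 (br01 G) \<and> bilin s1 s0 s1 (br10 G) \<and>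
     (\<forall>x y. br00 G x y = - br00 G y x) \<and> (\<forall>x v. br01 G x v = - br10 G v x) \<and>
     trilin s0 s0 s0 s1 (br3 G) \<and>
     (\<forall>x y z. br3 G y x z = - br3 G x y z) \<and> (\<forall>x y z. br3 G x z y = - br3 G x y z) \<and>
     (\<forall>x y z. br00 G x (br00 G y z) + br00 G y (br00 G z x) + br00 G z (br00 G x y) = 0) \<and>
     (\<forall>x y v. br01 G x (br01 G y v) + br01 G y (br10 G v x) + br10 G v (br00 G x y) = 0) \<and>
     (\<forall>x y z z'.
        br01 G x (br3 G y z z') - br01 G y (br3 G x z z')
          + br01 G z (br3 G x y z') - br01 G z' (br3 G x y z)
        = br3 G (br00 G x y) z z' - br3 G (br00 G x z) y z' + br3 G (br00 G x z') y z
          + br3 G (br00 G y z) x z' - br3 G (br00 G y z') x z + br3 G (br00 G z z') x y)"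

definition skeletal_rep ::
  "('k::field \<Rightarrow> 'a::ab_group_add \<Rightarrow> 'a) \<Rightarrow> ('k \<Rightarrow> 'b::ab_group_add \<Rightarrow> 'b) \<Rightarrow>
   ('k \<Rightarrow> 'c::ab_group_add \<Rightarrow> 'c) \<Rightarrow> ('k \<Rightarrow> 'd::ab_group_add \<Rightarrow> 'd) \<Rightarrow>
   ('a, 'b) skel_Linf \<Rightarrow> ('a, 'b, 'c, 'd) skel_act \<Rightarrow> bool" where
  "skeletal_rep s0 s1 t0 t1 G R \<longleftrightarrow>
     bilin s0 t0 t0 (act00 R) \<and> bilin s0 t1 t1 (act01 R) \<and> bilin s1 t0 t1 (act10 R) \<and>
     trilin s0 s0 t0 t1 (act3 R) \<and>
     (\<forall>x y v. act3 R x y v = - act3 R y x v) \<and>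
     (\<forall>x y u. act00 R x (act00 R y u) - act00 R y (act00 R x u) - act00 R (br00 G x y) u = 0) \<and>
     (\<forall>x y u. act01 R x (act01 R y u) - act01 R y (act01 R x u) - act01 R (br00 G x y) u = 0) \<and>
     (\<forall>x y z v.
        act01 R x (act3 R y z v) - act01 R y (act3 R x z v) + act01 R z (act3 R x y v)
          + act10 R (br3 G x y z) v
        = act3 R (br00 G x y) z v - act3 R (br00 G x z) y v + act3 R y z (act00 R x v)
          + act3 R (br00 G y z) x v - act3 R x z (act00 R y v) + act3 R x y (act00 R z v))"

text \<open>The compatibility of the binary operations holds in total degree 0 and 1. Its degree 0
  instances (the first two identities below, all arguments in \<open>g\<^sub>0\<close> and \<open>h\<^sub>0\<close>) are sometimes left
  unwritten; they do not follow from the degree 1 instances (take \<open>g\<^sub>1 = h\<^sub>1 = 0\<close>), and they make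
  \<open>(g\<^sub>0, h\<^sub>0)\<close> a matched pair of Lie algebras.\<close>

definition skeletal_matched_pair ::
  "('k::field \<Rightarrow> 'a::ab_group_add \<Rightarrow> 'a) \<Rightarrow> ('k \<Rightarrow> 'b::ab_group_add \<Rightarrow> 'b) \<Rightarrow>
   ('k \<Rightarrow> 'c::ab_group_add \<Rightarrow> 'c) \<Rightarrow> ('k \<Rightarrow> 'd::ab_group_add \<Rightarrow> 'd) \<Rightarrow>
   ('a, 'b) skel_Linf \<Rightarrow> ('c, 'd) skel_Linf \<Rightarrow>
   ('a, 'b, 'c, 'd) skel_act \<Rightarrow> ('c, 'd, 'a, 'b) skel_act \<Rightarrow> bool" where
  "skeletal_matched_pair sg0 sg1 sh0 sh1 G H R P \<longleftrightarrow>
     skeletal_Linf sg0 sg1 G \<and> skeletal_Linf sh0 sh1 H \<and>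
     skeletal_rep sg0 sg1 sh0 sh1 G R \<and> skeletal_rep sh0 sh1 sg0 sg1 H P \<and>
     (\<forall>x h k. act00 R x (br00 H h k) =
        br00 H (act00 R x h) k + br00 H h (act00 R x k)
        + act00 R (act00 P k x) h - act00 R (act00 P h x) k) \<and>
     (\<forall>h x y. act00 P h (br00 G x y) =
        br00 G (act00 P h x) y + br00 G x (act00 P h y)
        + act00 P (act00 R y h) x - act00 P (act00 R x h) y) \<and>
     (\<forall>x v h. act10 R (br01 G x v) h = act01 R x (act10 R v h) - act10 R v (act00 R x h)) \<and>
     (\<forall>h w x. act10 P (br01 H h w) x = act01 P h (act10 P w x) - act10 P w (act00 P h x)) \<and>
     (\<forall>x h w. act01 R x (br01 H h w) =
        br01 H (act00 R x h) w + br01 H h (act01 R x w)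
        + act10 R (act10 P w x) h - act01 R (act00 P h x) w) \<and>
     (\<forall>v h k. act10 R v (br00 H h k) =
        br10 H (act10 R v h) k + br01 H h (act10 R v k)
        + act10 R (act01 P k v) h - act10 R (act01 P h v) k) \<and>
     (\<forall>h x v. act01 P h (br01 G x v) =
        br01 G (act00 P h x) v + br01 G x (act01 P h v)
        + act10 P (act10 R v h) x - act01 P (act00 R x h) v) \<and>
     (\<forall>w x y. act10 P w (br00 G x y) =
        br10 G (act10 P w x) y + br01 G x (act10 P w y)
        + act10 P (act01 R y w) x - act10 P (act01 R x w) y) \<and>
     (\<forall>x y h k.
        br01 G x (act3 P h k y) - br01 G y (act3 P h k x) - act3 P h k (br00 G x y)
        - act3 P (act00 R x h) k y + act3 P (act00 R x k) h y
        + act3 P (act00 R y h) k x - act3 P (act00 R y k) h x = 0) \<and>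
     (\<forall>x h k k'.
        act01 R x (br3 H h k k') + act10 R (act3 P k k' x) h - act10 R (act3 P h k' x) k
        + act10 R (act3 P h k x) k' - br3 H (act00 R x h) k k'
        + br3 H (act00 R x k) h k' - br3 H (act00 R x k') h k = 0) \<and>
     (\<forall>x y h k.
        br01 H h (act3 R x y k) - br01 H k (act3 R x y h) - act3 R x y (br00 H h k)
        - act3 R (act00 P h x) y k + act3 R (act00 P h y) x k
        + act3 R (act00 P k x) y h - act3 R (act00 P k y) x h = 0) \<and>
     (\<forall>h x y z.
        act01 P h (br3 G x y z) + act10 P (act3 R y z h) x - act10 P (act3 R x z h) y
        + act10 P (act3 R x y h) z - br3 G (act00 P h x) y z
        + br3 G (act00 P h y) x z - br3 G (act00 P h z) x y = 0)"


section \<open>Matched pairs of Lie algebras and their representations\<close>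

definition lie_algebra ::
  "('k::field \<Rightarrow> 'a::ab_group_add \<Rightarrow> 'a) \<Rightarrow> ('a \<Rightarrow> 'a \<Rightarrow> 'a) \<Rightarrow> bool" where
  "lie_algebra s br \<longleftrightarrow>
     bilin s s s br \<and> (\<forall>x. br x x = 0) \<and>
     (\<forall>x y z. br x (br y z) + br y (br z x) + br z (br x y) = 0)"

definition lie_rep ::
  "('k::field \<Rightarrow> 'a::ab_group_add \<Rightarrow> 'a) \<Rightarrow> ('k \<Rightarrow> 'v::ab_group_add \<Rightarrow> 'v) \<Rightarrow>
   ('a \<Rightarrow> 'a \<Rightarrow> 'a) \<Rightarrow> ('a \<Rightarrow> 'v \<Rightarrow> 'v) \<Rightarrow> bool" where
  "lie_rep s sV br act \<longleftrightarrow>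
     bilin s sV sV act \<and> (\<forall>x y v. act (br x y) v = act x (act y v) - act y (act x v))"

record ('g, 'h) lie_pair =
  gbr :: "'g \<Rightarrow> 'g \<Rightarrow> 'g"
  hbr :: "'h \<Rightarrow> 'h \<Rightarrow> 'h"
  rho :: "'g \<Rightarrow> 'h \<Rightarrow> 'h"
  psi :: "'h \<Rightarrow> 'g \<Rightarrow> 'g"

definition lie_matched_pair ::
  "('k::field \<Rightarrow> 'g::ab_group_add \<Rightarrow> 'g) \<Rightarrow> ('k \<Rightarrow> 'h::ab_group_add \<Rightarrow> 'h) \<Rightarrow>
   ('g, 'h) lie_pair \<Rightarrow> bool" where
  "lie_matched_pair sg sh M \<longleftrightarrow>
     lie_algebra sg (gbr M) \<and> lie_algebra sh (hbr M) \<and>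
     lie_rep sg sh (gbr M) (rho M) \<and> lie_rep sh sg (hbr M) (psi M) \<and>
     (\<forall>x h k. rho M x (hbr M h k) =
        hbr M (rho M x h) k + hbr M h (rho M x k) + rho M (psi M k x) h - rho M (psi M h x) k) \<and>
     (\<forall>h x y. psi M h (gbr M x y) =
        gbr M (psi M h x) y + gbr M x (psi M h y) + psi M (rho M y h) x - psi M (rho M x h) y)"

record ('g, 'h, 'v, 'w) lie_pair_rep =
  rhoV :: "'g \<Rightarrow> 'v \<Rightarrow> 'v"
  rhoW :: "'g \<Rightarrow> 'w \<Rightarrow> 'w"
  psiV :: "'h \<Rightarrow> 'v \<Rightarrow> 'v"
  psiW :: "'h \<Rightarrow> 'w \<Rightarrow> 'w"
  alpha :: "'v \<Rightarrow> 'h \<Rightarrow> 'w"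
  beta :: "'w \<Rightarrow> 'g \<Rightarrow> 'v"

definition matched_pair_rep ::
  "('k::field \<Rightarrow> 'g::ab_group_add \<Rightarrow> 'g) \<Rightarrow> ('k \<Rightarrow> 'h::ab_group_add \<Rightarrow> 'h) \<Rightarrow>
   ('k \<Rightarrow> 'v::ab_group_add \<Rightarrow> 'v) \<Rightarrow> ('k \<Rightarrow> 'w::ab_group_add \<Rightarrow> 'w) \<Rightarrow>
   ('g, 'h) lie_pair \<Rightarrow> ('g, 'h, 'v, 'w) lie_pair_rep \<Rightarrow> bool" where
  "matched_pair_rep sg sh sV sW M R \<longleftrightarrow>
     lie_rep sg sV (gbr M) (rhoV R) \<and> lie_rep sg sW (gbr M) (rhoW R) \<and>
     lie_rep sh sV (hbr M) (psiV R) \<and> lie_rep sh sW (hbr M) (psiW R) \<and>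
     bilin sV sh sW (alpha R) \<and> bilin sW sg sV (beta R) \<and>
     (\<forall>x v h. alpha R (rhoV R x v) h = rhoW R x (alpha R v h) - alpha R v (rho M x h)) \<and>
     (\<forall>h w x. beta R (psiW R h w) x = psiV R h (beta R w x) - beta R w (psi M h x)) \<and>
     (\<forall>x h w. rhoW R x (psiW R h w) =
        psiW R (rho M x h) w + psiW R h (rhoW R x w)
        + alpha R (beta R w x) h - rhoW R (psi M h x) w) \<and>
     (\<forall>v h k. alpha R v (hbr M h k) =
        - psiW R k (alpha R v h) + psiW R h (alpha R v k)
        + alpha R (psiV R k v) h - alpha R (psiV R h v) k) \<and>
     (\<forall>h x v. psiV R h (rhoV R x v) =
        rhoV R (psi M h x) v + rhoV R x (psiV R h v)
        + beta R (alpha R v h) x - psiV R (rho M x h) v) \<and>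
     (\<forall>w x y. beta R w (gbr M x y) =
        - rhoV R y (beta R w x) + rhoV R x (beta R w y)
        + beta R (rhoW R y w) x - beta R (rhoW R x w) y)"


section \<open>Cochains and the coboundary\<close>

text \<open>\<open>alt_hom sg sh sV p q\<close> is Hom(\<open>\<Lambda>\<^sup>p g \<otimes> \<Lambda>\<^sup>q h\<close>, \<open>V\<close>): maps of \<open>p\<close> arguments in \<open>g\<close> and
  \<open>q\<close> arguments in \<open>h\<close>, linear in each argument and vanishing when two \<open>g\<close>-arguments or two
  \<open>h\<close>-arguments coincide. The value 0 on lists of other lengths makes the
  representation of such a map unique.\<close>

definition alt_hom ::
  "('k::field \<Rightarrow> 'g::ab_group_add \<Rightarrow> 'g) \<Rightarrow> ('k \<Rightarrow> 'h::ab_group_add \<Rightarrow> 'h) \<Rightarrow>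
   ('k \<Rightarrow> 'v::ab_group_add \<Rightarrow> 'v) \<Rightarrow> nat \<Rightarrow> nat \<Rightarrow> ('g list \<Rightarrow> 'h list \<Rightarrow> 'v) set" where
  "alt_hom sg sh sV p q =
     {F. (\<forall>xs hs. (length xs \<noteq> p \<or> length hs \<noteq> q) \<longrightarrow> F xs hs = 0) \<and>
         (\<forall>xs hs. length xs = p \<longrightarrow> length hs = q \<longrightarrow>
            (\<forall>i<p. Vector_Spaces.linear sg sV (\<lambda>t. F (xs[i := t]) hs)) \<and>
            (\<forall>j<q. Vector_Spaces.linear sh sV (\<lambda>t. F xs (hs[j := t]))) \<and>
            (\<not> distinct xs \<or> \<not> distinct hs \<longrightarrow> F xs hs = 0))}"

type_synonym ('g, 'h, 'v, 'w) cochain =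
  "('g list \<Rightarrow> 'h list \<Rightarrow> 'v) \<times> ('g list \<Rightarrow> 'h list \<Rightarrow> 'w)"

definition bicochains ::
  "('k::field \<Rightarrow> 'g::ab_group_add \<Rightarrow> 'g) \<Rightarrow> ('k \<Rightarrow> 'h::ab_group_add \<Rightarrow> 'h) \<Rightarrow>
   ('k \<Rightarrow> 'v::ab_group_add \<Rightarrow> 'v) \<Rightarrow> ('k \<Rightarrow> 'w::ab_group_add \<Rightarrow> 'w) \<Rightarrow>
   nat \<Rightarrow> nat \<Rightarrow> ('g, 'h, 'v, 'w) cochain set" where
  "bicochains sg sh sV sW k l = alt_hom sg sh sV (k + 1) l \<times> alt_hom sg sh sW k (l + 1)"

text \<open>An element \<open>(F\<^sub>1, \<dots>, F\<^sub>n)\<close> of \<open>C\<^sup>n\<close> is the list of its components, so \<open>F\<^sub>r\<close> is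
  \<open>Fs ! (r - 1)\<close>.\<close>

definition cochains ::
  "('k::field \<Rightarrow> 'g::ab_group_add \<Rightarrow> 'g) \<Rightarrow> ('k \<Rightarrow> 'h::ab_group_add \<Rightarrow> 'h) \<Rightarrow>
   ('k \<Rightarrow> 'v::ab_group_add \<Rightarrow> 'v) \<Rightarrow> ('k \<Rightarrow> 'w::ab_group_add \<Rightarrow> 'w) \<Rightarrow>
   nat \<Rightarrow> ('g, 'h, 'v, 'w) cochain list set" where
  "cochains sg sh sV sW n =
     {Fs. length Fs = n \<and> (\<forall>r\<in>{1..n}. Fs ! (r - 1) \<in> bicochains sg sh sV sW (n - r) (r - 1))}"

text \<open>Argument lists are indexed from 1, as in the usual formulas: \<open>arg xs i\<close> is \<open>x\<^sub>i\<close>,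
  \<open>omit i xs\<close> deletes \<open>x\<^sub>i\<close>, \<open>put i t xs\<close> replaces \<open>x\<^sub>i\<close> by \<open>t\<close>, and \<open>signed m v\<close> is \<open>(-1)\<^sup>m v\<close>.\<close>

definition arg :: "'a list \<Rightarrow> nat \<Rightarrow> 'a" where
  "arg xs i = xs ! (i - 1)"

definition omit :: "nat \<Rightarrow> 'a list \<Rightarrow> 'a list" where
  "omit i xs = take (i - 1) xs @ drop i xs"

definition put :: "nat \<Rightarrow> 'a \<Rightarrow> 'a list \<Rightarrow> 'a list" where
  "put i t xs = xs[i - 1 := t]"

definition signed :: "nat \<Rightarrow> 'a::ab_group_add \<Rightarrow> 'a" where
  "signed m v = (if even m then v else - v)"

text \<open>The two partial coboundaries on \<open>F\<^sub>r \<in> C\<^sup>n\<^sup>-\<^sup>r\<^sup>|\<^sup>r\<^sup>-\<^sup>1\<close>. Together they are the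
  Chevalley--Eilenberg coboundary of the bicrossed product Lie algebra on \<open>g \<oplus> h\<close>, with bracket
  \<open>[x, h] = \<rho>\<^sub>x h - \<psi>\<^sub>h x\<close>, acting on \<open>V \<oplus> W\<close> by \<open>x \<cdot> w = (\<rho>\<^sub>W)\<^sub>x w - \<beta>\<^sub>w x\<close> and
  \<open>h \<cdot> v = (\<psi>\<^sub>V)\<^sub>h v - \<alpha>\<^sub>v h\<close>. This fixes the signs of the mixed terms: moving \<open>\<rho>\<close> of
  \<open>x\<^sub>i\<close> and \<open>h\<^sub>j\<close> into the place of \<open>h\<^sub>j\<close> gives \<open>(-1)\<^sup>i\<close>, and moving \<open>\<psi>\<close> of \<open>h\<^sub>j\<close> and \<open>x\<^sub>i\<close>
  into the place of \<open>x\<^sub>i\<close> gives \<open>(-1)\<^sup>m\<^sup>+\<^sup>j\<close>, with \<open>m\<close> the number of \<open>g\<close>-arguments of the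
  result. In the literature the exponents of these mixed terms also appear as \<open>n - r + i\<close> and
  \<open>n - r + i + 1\<close> (for \<open>\<rho>\<close>) and \<open>n - r + j\<close> and \<open>n - r + j + 1\<close> (for \<open>\<psi>\<close>); with those
  exponents the square of the coboundary is not zero, so the signs here are the corrected ones.
  All other signs agree.\<close>

definition delta_mu_rho ::
  "('g, 'h) lie_pair \<Rightarrow> ('g, 'h, 'v::ab_group_add, 'w::ab_group_add) lie_pair_rep \<Rightarrow>
   nat \<Rightarrow> nat \<Rightarrow> ('g, 'h, 'v, 'w) cochain \<Rightarrow> ('g, 'h, 'v, 'w) cochain" where
  "delta_mu_rho M R n r F =
    ((\<lambda>xs hs. if length xs = n - r + 2 \<and> length hs = r - 1 then
        (\<Sum>i=1..n-r+2. signed (i + 1) (rhoV R (arg xs i) (fst F (omit i xs) hs)))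
      + (\<Sum>j=1..n-r+2. \<Sum>i=1..<j.
           signed (i + j) (fst F (gbr M (arg xs i) (arg xs j) # omit i (omit j xs)) hs))
      + (\<Sum>i=1..n-r+2. \<Sum>j=1..r-1.
           signed i (fst F (omit i xs) (put j (rho M (arg xs i) (arg hs j)) hs)))
      else 0),
     (\<lambda>xs hs. if length xs = n - r + 1 \<and> length hs = r then
        (\<Sum>i=1..n-r+1. signed (i + 1) (rhoW R (arg xs i) (snd F (omit i xs) hs)))
      + (\<Sum>i=1..r. signed (n - r + i + 1) (alpha R (fst F xs (omit i hs)) (arg hs i)))
      + (\<Sum>j=1..n-r+1. \<Sum>i=1..<j.
           signed (i + j) (snd F (gbr M (arg xs i) (arg xs j) # omit i (omit j xs)) hs))
      + (\<Sum>i=1..n-r+1. \<Sum>j=1..r.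
           signed i (snd F (omit i xs) (put j (rho M (arg xs i) (arg hs j)) hs)))
      else 0))"

definition delta_psi_nu ::
  "('g, 'h) lie_pair \<Rightarrow> ('g, 'h, 'v::ab_group_add, 'w::ab_group_add) lie_pair_rep \<Rightarrow>
   nat \<Rightarrow> nat \<Rightarrow> ('g, 'h, 'v, 'w) cochain \<Rightarrow> ('g, 'h, 'v, 'w) cochain" where
  "delta_psi_nu M R n r F =
    ((\<lambda>xs hs. if length xs = n - r + 1 \<and> length hs = r then
        (\<Sum>i=1..n-r+1. signed i (beta R (snd F (omit i xs) hs) (arg xs i)))
      + (\<Sum>i=1..r. signed (n - r + i) (psiV R (arg hs i) (fst F xs (omit i hs))))
      + (\<Sum>i=1..n-r+1. \<Sum>j=1..r.
           signed (n - r + 1 + j) (fst F (put i (psi M (arg hs j) (arg xs i)) xs) (omit j hs)))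
      + (\<Sum>k=1..r. \<Sum>j=1..<k.
           signed (n - r + 1 + j + k) (fst F xs (hbr M (arg hs j) (arg hs k) # omit j (omit k hs))))
      else 0),
     (\<lambda>xs hs. if length xs = n - r \<and> length hs = r + 1 then
        (\<Sum>i=1..r+1. signed (n - r + i + 1) (psiW R (arg hs i) (snd F xs (omit i hs))))
      + (\<Sum>i=1..n-r. \<Sum>j=1..r+1.
           signed (n - r + j) (snd F (put i (psi M (arg hs j) (arg xs i)) xs) (omit j hs)))
      + (\<Sum>k=1..r+1. \<Sum>j=1..<k.
           signed (n - r + j + k) (snd F xs (hbr M (arg hs j) (arg hs k) # omit j (omit k hs))))
      else 0))"

definition delta_MPL ::
  "('g, 'h) lie_pair \<Rightarrow> ('g, 'h, 'v::ab_group_add, 'w::ab_group_add) lie_pair_rep \<Rightarrow>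
   nat \<Rightarrow> ('g, 'h, 'v, 'w) cochain list \<Rightarrow> ('g, 'h, 'v, 'w) cochain list" where
  "delta_MPL M R n Fs =
     map (\<lambda>r. (if r \<le> n then delta_mu_rho M R n r (Fs ! (r - 1)) else 0)
            + (if 2 \<le> r then delta_psi_nu M R n (r - 1) (Fs ! (r - 2)) else 0)) [1..<n + 2]"


section \<open>The two sets and the correspondence\<close>

definition skeletal_matched_pairs ::
  "('k::field \<Rightarrow> 'a::ab_group_add \<Rightarrow> 'a) \<Rightarrow> ('k \<Rightarrow> 'b::ab_group_add \<Rightarrow> 'b) \<Rightarrow>
   ('k \<Rightarrow> 'c::ab_group_add \<Rightarrow> 'c) \<Rightarrow> ('k \<Rightarrow> 'd::ab_group_add \<Rightarrow> 'd) \<Rightarrow>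
   (('a, 'b) skel_Linf \<times> ('c, 'd) skel_Linf \<times>
    ('a, 'b, 'c, 'd) skel_act \<times> ('c, 'd, 'a, 'b) skel_act) set" where
  "skeletal_matched_pairs sg0 sg1 sh0 sh1 =
     {(G, H, R, P). skeletal_matched_pair sg0 sg1 sh0 sh1 G H R P}"

definition cocycle_triples ::
  "('k::field \<Rightarrow> 'g::ab_group_add \<Rightarrow> 'g) \<Rightarrow> ('k \<Rightarrow> 'h::ab_group_add \<Rightarrow> 'h) \<Rightarrow>
   ('k \<Rightarrow> 'v::ab_group_add \<Rightarrow> 'v) \<Rightarrow> ('k \<Rightarrow> 'w::ab_group_add \<Rightarrow> 'w) \<Rightarrow>
   (('g, 'h) lie_pair \<times> ('g, 'h, 'v, 'w) lie_pair_rep \<times> ('g, 'h, 'v, 'w) cochain list) set" where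
  "cocycle_triples sg sh sV sW =
     {(M, R, [F1, 0, F3]) | M R F1 F3.
        lie_matched_pair sg sh M \<and> matched_pair_rep sg sh sV sW M R \<and>
        [F1, 0, F3] \<in> cochains sg sh sV sW 3 \<and>
        delta_MPL M R 3 [F1, 0, F3] = [0, 0, 0, 0]}"

text \<open>Here \<open>g = g\<^sub>0\<close>, \<open>V = g\<^sub>1\<close>, \<open>h = h\<^sub>0\<close>, \<open>W = h\<^sub>1\<close>; the binary operations are split
  by degree, \<open>F\<^sub>1 = (\<mu>\<^sub>3, \<rho>\<^sub>3)\<close>, and \<open>F\<^sub>3 = (\<psi>\<^sub>3, \<nu>\<^sub>3)\<close> with the arguments of \<open>\<psi>\<^sub>3\<close> reordered.\<close>

definition to_triple ::
  "('a, 'b::zero) skel_Linf \<times> ('c, 'd::zero) skel_Linf \<times>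
   ('a, 'b, 'c, 'd) skel_act \<times> ('c, 'd, 'a, 'b) skel_act \<Rightarrow>
   ('a, 'c) lie_pair \<times> ('a, 'c, 'b, 'd) lie_pair_rep \<times> ('a, 'c, 'b, 'd) cochain list" where
  "to_triple = (\<lambda>(G, H, R, P).
     (\<lparr> gbr = br00 G, hbr = br00 H, rho = act00 R, psi = act00 P \<rparr>,
      \<lparr> rhoV = br01 G, rhoW = act01 R, psiV = act01 P, psiW = br01 H,
        alpha = act10 R, beta = act10 P \<rparr>,
      [ (\<lambda>xs hs. case (xs, hs) of ([x, y, z], []) \<Rightarrow> br3 G x y z | _ \<Rightarrow> 0,
         \<lambda>xs hs. case (xs, hs) of ([x, y], [h]) \<Rightarrow> act3 R x y h | _ \<Rightarrow> 0),
        0,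
        (\<lambda>xs hs. case (xs, hs) of ([x], [h, k]) \<Rightarrow> act3 P h k x | _ \<Rightarrow> 0,
         \<lambda>xs hs. case (xs, hs) of ([], [h, k, l]) \<Rightarrow> br3 H h k l | _ \<Rightarrow> 0) ]))"

end

theory Submission
  imports Defs
begin

text \<open>The bracket \<open>br10\<close> of a skeletal algebra is determined by \<open>br01\<close>, so the binary data of a matched
  pair is exactly a matched pair of Lie algebras with a representation. In characteristic zero,
  skew-symmetric trilinear maps are the same as alternating ones, so the ternary operations are
  exactly a cochain \<open>(F\<^sub>1, 0, F\<^sub>3)\<close>. Since \<open>F\<^sub>2 = 0\<close>, each of the four slots of
  its coboundary holds a single term \<open>\<delta>(F\<^sub>1)\<close> or \<open>\<delta>(F\<^sub>3)\<close>, and up to sign the eight components are the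
  eight ternary identities of a skeletal matched pair.\<close>

section \<open>Linearity, and skew-symmetry in characteristic zero\<close>

lemma linear_fun_0: "Vector_Spaces.linear s1 s2 f \<Longrightarrow> f 0 = 0"
  by (metis Vector_Spaces.linear_iff add_cancel_right_left)

lemma linear_neg_fun:
  "Vector_Spaces.linear s1 s2 f \<Longrightarrow> Vector_Spaces.linear s1 s2 (\<lambda>x. - f x)"
  by (simp add: Vector_Spaces.linear_iff module_iff_vector_space[symmetric] module.scale_minus_right)

text \<open>From \<open>u = - u\<close> comes \<open>2 u = 0\<close>, and 2 is invertible in
  characteristic zero. Later appeals to the characteristic all pass through this fact.\<close>

lemma self_neg_eq_0:
  fixes s :: "'k::field_char_0 \<Rightarrow> 'v::ab_group_add \<Rightarrow> 'v"
    and u :: 'v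
  assumes "vector_space s" and "u = - u"
  shows "u = 0"
proof -
  interpret vector_space s by fact
  have "s 2 u = s 1 u + s 1 u"
    by (metis one_add_one scale_left_distrib)
  also have "\<dots> = 0"
    using assms(2) by (metis add.right_inverse scale_one)
  finally show ?thesis
    by simp
qed

text \<open>Equal arguments give \<open>f x x = - f x x\<close>, hence zero; conversely
  \<open>f (x + y) (x + y)\<close> is expanded (polarization). This mediates between the sign rules
  of skeletal algebras and the vanishing conditions in \<open>lie_algebra\<close> and
  \<open>alt_hom\<close>.\<close>

lemma skew_iff_alternating:
  fixes sA :: "'k::field_char_0 \<Rightarrow> 'a::ab_group_add \<Rightarrow> 'a"
  assumes "bilin sA sA sV f"
  shows "(\<forall>x y. f x y = - f y x) \<longleftrightarrow> (\<forall>x. f x x = 0)"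
proof
  assume "\<forall>x y. f x y = - f y x"
  then show "\<forall>x. f x x = 0"
    using assms self_neg_eq_0 unfolding bilin_def Vector_Spaces.linear_iff by metis
next
  assume alt: "\<forall>x. f x x = 0"
  have "f x y = - f y x" for x y
  proof -
    have "f (x + y) (x + y) = f x x + f y x + (f x y + f y y)"
      using assms unfolding bilin_def Vector_Spaces.linear_iff by metis
    then show ?thesis
      using alt by (simp add: eq_neg_iff_add_eq_0 add.commute)
  qed
  then show "\<forall>x y. f x y = - f y x" by blast
qed

section \<open>Trilinear maps encoded as cochains\<close>

text \<open>\<open>ofpq f\<close> encodes \<open>f\<close> as a map of \<open>p\<close> arguments in \<open>g\<close> and \<open>q\<close> in \<open>h\<close>; \<open>of12\<close> takes its
  argument with the \<open>h\<close>-slots first, as in \<open>\<psi>\<^sub>3\<close>.\<close>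

definition of30 :: "('g \<Rightarrow> 'g \<Rightarrow> 'g \<Rightarrow> 'v::zero) \<Rightarrow> 'g list \<Rightarrow> 'h list \<Rightarrow> 'v" where
  "of30 f = (\<lambda>xs hs. case (xs, hs) of ([x, y, z], []) \<Rightarrow> f x y z | _ \<Rightarrow> 0)"

definition of21 :: "('g \<Rightarrow> 'g \<Rightarrow> 'h \<Rightarrow> 'v::zero) \<Rightarrow> 'g list \<Rightarrow> 'h list \<Rightarrow> 'v" where
  "of21 f = (\<lambda>xs hs. case (xs, hs) of ([x, y], [h]) \<Rightarrow> f x y h | _ \<Rightarrow> 0)"

definition of12 :: "('h \<Rightarrow> 'h \<Rightarrow> 'g \<Rightarrow> 'v::zero) \<Rightarrow> 'g list \<Rightarrow> 'h list \<Rightarrow> 'v" where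
  "of12 f = (\<lambda>xs hs. case (xs, hs) of ([x], [h, k]) \<Rightarrow> f h k x | _ \<Rightarrow> 0)"

definition of03 :: "('h \<Rightarrow> 'h \<Rightarrow> 'h \<Rightarrow> 'v::zero) \<Rightarrow> 'g list \<Rightarrow> 'h list \<Rightarrow> 'v" where
  "of03 f = (\<lambda>xs hs. case (xs, hs) of ([], [h, k, l]) \<Rightarrow> f h k l | _ \<Rightarrow> 0)"

lemma encode_simps [simp]:
  "of30 f [x, y, z] [] = f x y z"
  "of21 f' [x, y] [h] = f' x y h"
  "of12 p [x] [h, k] = p h k x"
  "of03 p' [] [h, k, l] = p' h k l"
  by (simp_all add: of30_def of21_def of12_def of03_def)

lemma encode_outside:
  "length xs \<noteq> 3 \<or> length hs \<noteq> 0 \<Longrightarrow> of30 f xs hs = 0"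
  "length xs \<noteq> 2 \<or> length hs \<noteq> 1 \<Longrightarrow> of21 f' xs hs = 0"
  "length xs \<noteq> 1 \<or> length hs \<noteq> 2 \<Longrightarrow> of12 p xs hs = 0"
  "length xs \<noteq> 0 \<or> length hs \<noteq> 3 \<Longrightarrow> of03 p' xs hs = 0"
  by (auto simp: of30_def of21_def of12_def of03_def split: list.splits)

text \<open>Inverts the encodings: a cochain that is zero on lists of all other lengths is recovered
  from its values on lists of the right lengths. Surjectivity of \<open>to_triple\<close> rests on
  this.\<close>

lemma encode_eqI:
  "(\<And>xs hs. length xs \<noteq> 3 \<or> length hs \<noteq> 0 \<Longrightarrow> F xs hs = 0) \<Longrightarrow> of30 (\<lambda>x y z. F [x, y, z] []) = F"
  "(\<And>xs hs. length xs \<noteq> 2 \<or> length hs \<noteq> 1 \<Longrightarrow> F xs hs = 0) \<Longrightarrow> of21 (\<lambda>x y h. F [x, y] [h]) = F"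
  "(\<And>xs hs. length xs \<noteq> 1 \<or> length hs \<noteq> 2 \<Longrightarrow> F xs hs = 0) \<Longrightarrow> of12 (\<lambda>h k x. F [x] [h, k]) = F"
  "(\<And>xs hs. length xs \<noteq> 0 \<or> length hs \<noteq> 3 \<Longrightarrow> F xs hs = 0) \<Longrightarrow> of03 (\<lambda>h k l. F [] [h, k, l]) = F"
  by (rule ext; rule ext; fastforce simp: of30_def of21_def of12_def of03_def split: list.splits)+

section \<open>Alternating cochains versus skew trilinear maps\<close>

lemma all_length_Suc:
  "(\<forall>xs. length xs = Suc n \<longrightarrow> Q xs) \<longleftrightarrow> (\<forall>x xs. length xs = n \<longrightarrow> Q (x # xs))"
  by (auto simp: length_Suc_conv)

lemma all_less_Suc_0: "(\<forall>i<Suc n. Q i) \<longleftrightarrow> Q 0 \<and> (\<forall>i<n. Q (Suc i))"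
  by (auto simp: less_Suc_eq_0_disj)

text \<open>Each length premise stands next to its quantifier, the shape that
  \<open>all_length_Suc\<close> rewrites. For concrete \<open>p\<close> and \<open>q\<close>,
  quantifiers over lists then become quantifiers over entries, and those over positions become
  finite conjunctions.\<close>

lemma alt_hom_split:
  "F \<in> alt_hom sg sh sV p q \<longleftrightarrow>
     (\<forall>xs hs. (length xs \<noteq> p \<or> length hs \<noteq> q) \<longrightarrow> F xs hs = 0) \<and>
     (\<forall>xs. length xs = p \<longrightarrow> (\<forall>hs. length hs = q \<longrightarrow>
        (\<forall>i<p. Vector_Spaces.linear sg sV (\<lambda>t. F (xs[i := t]) hs)) \<and>
        (\<forall>j<q. Vector_Spaces.linear sh sV (\<lambda>t. F xs (hs[j := t]))) \<and>
        (\<not> distinct xs \<or> \<not> distinct hs \<longrightarrow> F xs hs = 0)))"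
  unfolding alt_hom_def by blast

lemma trilin_skew_iff:
  fixes sA :: "'k::field_char_0 \<Rightarrow> 'a::ab_group_add \<Rightarrow> 'a"
  assumes "trilin sA sA sV sW f"
  shows "(\<forall>x y z. f x y z = - f y x z) \<longleftrightarrow> (\<forall>x z. f x x z = 0)"
proof -
  have "bilin sA sA sW (\<lambda>x y. f x y z)" for z
    using assms by (simp add: bilin_def trilin_def)
  from skew_iff_alternating[OF this] show ?thesis by blast
qed

text \<open>Swaps of neighbouring slots generate all permutations, and one swap reduces the case
  \<open>x = z\<close> to equal neighbours. The right side is what failure of
  \<open>distinct [x, y, z]\<close> amounts to.\<close>

lemma trilin_totally_skew_iff:
  fixes sA :: "'k::field_char_0 \<Rightarrow> 'a::ab_group_add \<Rightarrow> 'a"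
  assumes "trilin sA sA sA sW f"
  shows "(\<forall>x y z. f y x z = - f x y z) \<and> (\<forall>x y z. f x z y = - f x y z) \<longleftrightarrow>
    (\<forall>x y z. x = y \<or> x = z \<or> y = z \<longrightarrow> f x y z = 0)"
proof -
  have "bilin sA sA sW (\<lambda>x y. f x y z)" "bilin sA sA sW (f z)" for z
    using assms by (simp_all add: bilin_def trilin_def)
  note * = this[THEN skew_iff_alternating]
  show ?thesis
  proof
    assume l: "(\<forall>x y z. f y x z = - f x y z) \<and> (\<forall>x y z. f x z y = - f x y z)"
    then have "f x x z = 0" "f x z z = 0" for x z
      using * by blast+
    then show "\<forall>x y z. x = y \<or> x = z \<or> y = z \<longrightarrow> f x y z = 0"
      using l by (metis neg_0_equal_iff_equal)
  next
    assume "\<forall>x y z. x = y \<or> x = z \<or> y = z \<longrightarrow> f x y z = 0"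
    then have "\<forall>x. f x x z = 0" "\<forall>x. f z x x = 0" for z
      by simp_all
    then show "(\<forall>x y z. f y x z = - f x y z) \<and> (\<forall>x y z. f x z y = - f x y z)"
      unfolding *[symmetric] by blast
  qed
qed

lemma of30_alt_hom_iff:
  fixes sA :: "'k::field_char_0 \<Rightarrow> 'a::ab_group_add \<Rightarrow> 'a"
  shows "of30 f \<in> alt_hom sA sB sV 3 0 \<longleftrightarrow>
    trilin sA sA sA sV f \<and>
    (\<forall>x y z. f y x z = - f x y z) \<and> (\<forall>x y z. f x z y = - f x y z)"
    (is "_ \<longleftrightarrow> ?rhs")
proof -
  have "of30 f \<in> alt_hom sA sB sV 3 0 \<longleftrightarrow> trilin sA sA sA sV f \<and>
    (\<forall>x y z. x = y \<or> x = z \<or> y = z \<longrightarrow> f x y z = 0)"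
    by (simp add: alt_hom_split encode_outside numeral_eq_Suc all_length_Suc all_less_Suc_0 trilin_def
        all_conj_distrib conj_assoc)
  also have "\<dots> \<longleftrightarrow> ?rhs"
    by (intro conj_cong refl trilin_totally_skew_iff[symmetric])
  finally show ?thesis .
qed

lemma of03_alt_hom_iff:
  fixes sB :: "'k::field_char_0 \<Rightarrow> 'a::ab_group_add \<Rightarrow> 'a"
  shows "of03 f \<in> alt_hom sA sB sV 0 3 \<longleftrightarrow>
    trilin sB sB sB sV f \<and>
    (\<forall>x y z. f y x z = - f x y z) \<and> (\<forall>x y z. f x z y = - f x y z)"
    (is "_ \<longleftrightarrow> ?rhs")
proof -
  have "of03 f \<in> alt_hom sA sB sV 0 3 \<longleftrightarrow> trilin sB sB sB sV f \<and>
    (\<forall>x y z. x = y \<or> x = z \<or> y = z \<longrightarrow> f x y z = 0)"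
    by (simp add: alt_hom_split encode_outside numeral_eq_Suc all_length_Suc all_less_Suc_0 trilin_def
        all_conj_distrib conj_assoc)
  also have "\<dots> \<longleftrightarrow> ?rhs"
    by (intro conj_cong refl trilin_totally_skew_iff[symmetric])
  finally show ?thesis .
qed

text \<open>A one-element list is always distinct, so only the two \<open>g\<close>-slots impose a
  condition and a single sign rule suffices.\<close>

lemma of21_alt_hom_iff:
  fixes sA :: "'k::field_char_0 \<Rightarrow> 'a::ab_group_add \<Rightarrow> 'a"
  shows "of21 f \<in> alt_hom sA sB sV 2 1 \<longleftrightarrow> trilin sA sA sB sV f \<and> (\<forall>x y z. f x y z = - f y x z)"
proof -
  have "of21 f \<in> alt_hom sA sB sV 2 1 \<longleftrightarrow> trilin sA sA sB sV f \<and> (\<forall>x z. f x x z = 0)"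
    using encode_outside(2)[of _ _ f]
    by (simp add: alt_hom_split numeral_eq_Suc all_length_Suc all_less_Suc_0 trilin_def) blast
  then show ?thesis
    using trilin_skew_iff by blast
qed

lemma of12_alt_hom_iff:
  fixes sB :: "'k::field_char_0 \<Rightarrow> 'a::ab_group_add \<Rightarrow> 'a"
  shows "of12 f \<in> alt_hom sA sB sV 1 2 \<longleftrightarrow> trilin sB sB sA sV f \<and> (\<forall>x y z. f x y z = - f y x z)"
proof -
  have "of12 f \<in> alt_hom sA sB sV 1 2 \<longleftrightarrow> trilin sB sB sA sV f \<and> (\<forall>x z. f x x z = 0)"
    using encode_outside(3)[of _ _ f]
    by (simp add: alt_hom_split numeral_eq_Suc all_length_Suc all_less_Suc_0 trilin_def) blast
  then show ?thesis
    using trilin_skew_iff by blast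
qed

section \<open>The coboundaries of \<open>F_1\<close> and \<open>F_3\<close>, component by
  component\<close>

lemma if_length_eq_0_iff:
  "(\<lambda>xs hs. if length xs = p \<and> length hs = q then Q xs hs else 0) = 0 \<longleftrightarrow>
   (\<forall>xs. length xs = p \<longrightarrow> (\<forall>hs. length hs = q \<longrightarrow> Q xs hs = 0))"
  by (auto simp: fun_eq_iff)

lemma signed_rec: "signed 0 v = v" "signed (Suc n) v = - signed n v"
  by (simp_all add: signed_def)

text \<open>Adapts quantifier order: evaluating a cochain introduces the \<open>g\<close>-arguments
  before the \<open>h\<close>-arguments, while some identities for \<open>psi\<close> quantify over
  \<open>h\<close> first.\<close>

lemma all_last_first: "(\<forall>h x y z. Q x y z h) \<longleftrightarrow> (\<forall>x y z h. Q x y z h)"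
  by blast

text \<open>Yields the ternary axioms of \<open>G\<close> and of its representation. Once the sums
  are expanded, the arguments already stand in the order used there, and only rearrangement of terms
  remains.\<close>

lemma delta_mu_rho_F1:
  fixes M :: "('g, 'h) lie_pair"
    and R :: "('g, 'h, 'v::ab_group_add, 'w::ab_group_add) lie_pair_rep"
  shows "delta_mu_rho M R 3 (Suc 0) (of30 m, of21 r) = 0 \<longleftrightarrow>
   (\<forall>x y z z'. rhoV R x (m y z z') - rhoV R y (m x z z') + rhoV R z (m x y z') - rhoV R z' (m x y z)
        = m (gbr M x y) z z' - m (gbr M x z) y z' + m (gbr M x z') y z
          + m (gbr M y z) x z' - m (gbr M y z') x z + m (gbr M z z') x y) \<and>
   (\<forall>x y z v. rhoW R x (r y z v) - rhoW R y (r x z v) + rhoW R z (r x y v) + alpha R (m x y z) v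
        = r (gbr M x y) z v - r (gbr M x z) y v + r y z (rho M x v)
          + r (gbr M y z) x v - r x z (rho M y v) + r x y (rho M z v))"
  unfolding delta_mu_rho_def zero_prod_def prod.inject if_length_eq_0_iff
  apply (simp add: numeral_eq_Suc all_length_Suc sum.cl_ivl_Suc sum.op_ivl_Suc
      arg_def omit_def put_def signed_rec)
  apply (intro conj_cong all_cong1)
  apply (simp_all add: algebra_simps)
  done

text \<open>Yields two compatibility identities of \<open>skeletal_matched_pair\<close>. The
  coboundary leaves \<open>psi M h y\<close> in the slot of \<open>y\<close>, whereas the identities
  have it in front; the skew-symmetry hypotheses account for the move.\<close>

lemma delta_psi_nu_F1:
  fixes M :: "('g, 'h) lie_pair"
    and R :: "('g, 'h, 'v::ab_group_add, 'w::ab_group_add) lie_pair_rep"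
  assumes "\<forall>x y z. m y x z = - m x y z" "\<forall>x y z. m x z y = - m x y z" "\<forall>x y z. r x y z = - r y x z"
  shows "delta_psi_nu M R 3 (Suc 0) (of30 m, of21 r) = 0 \<longleftrightarrow>
   (\<forall>h x y z. psiV R h (m x y z) + beta R (r y z h) x - beta R (r x z h) y + beta R (r x y h) z
       - m (psi M h x) y z + m (psi M h y) x z - m (psi M h z) x y = 0) \<and>
   (\<forall>x y h k. psiW R h (r x y k) - psiW R k (r x y h) - r x y (hbr M h k)
       - r (psi M h x) y k + r (psi M h y) x k + r (psi M k x) y h - r (psi M k y) x h = 0)"
proof -
  \<comment> \<open>Reaching the front from the third slot takes two transpositions, hence no sign
    there.\<close>
  have skew: "m x (psi M h y) z = - m (psi M h y) x z" "m x y (psi M h z) = m (psi M h z) x y"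
    "r x (psi M h y) k = - r (psi M h y) x k" for x y z h k
    using assms by metis+
  show ?thesis
    unfolding delta_psi_nu_def zero_prod_def prod.inject if_length_eq_0_iff
    apply (simp add: numeral_eq_Suc all_length_Suc sum.cl_ivl_Suc sum.op_ivl_Suc
        arg_def omit_def put_def signed_rec)
    apply (intro conj_cong)
    subgoal
      \<comment> \<open>This component is minus the identity. Reversing one equation with 0 lets
        \<open>algebra_simps\<close> collect the terms of both equations on matching sides.\<close>
      by (rule trans[OF _ all_last_first[symmetric]], intro all_cong1,
        subst eq_commute[of _ 0], simp add: algebra_simps skew)
    subgoal by (intro all_cong1, simp add: algebra_simps skew)
    done
qed

text \<open>The counterpart of \<open>delta_psi_nu_F1\<close> with the two algebras exchanged: now
  \<open>rho M x k\<close> is moved to the front of the \<open>h\<close>-slots.\<close>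

lemma delta_mu_rho_F3:
  fixes M :: "('g, 'h) lie_pair"
    and R :: "('g, 'h, 'v::ab_group_add, 'w::ab_group_add) lie_pair_rep"
  assumes "\<forall>h k l. n k h l = - n h k l" "\<forall>h k l. n h l k = - n h k l" "\<forall>h k x. p h k x = - p k h x"
  shows "delta_mu_rho M R 3 3 (of12 p, of03 n) = 0 \<longleftrightarrow>
   (\<forall>x y h k. rhoV R x (p h k y) - rhoV R y (p h k x) - p h k (gbr M x y)
       - p (rho M x h) k y + p (rho M x k) h y + p (rho M y h) k x - p (rho M y k) h x = 0) \<and>
   (\<forall>x h k l. rhoW R x (n h k l) + alpha R (p k l x) h - alpha R (p h l x) k + alpha R (p h k x) l
       - n (rho M x h) k l + n (rho M x k) h l - n (rho M x l) h k = 0)"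
proof -
  have skew: "n h (rho M x k) l = - n (rho M x k) h l" "n h k (rho M x l) = n (rho M x l) h k"
    "p h (rho M x k) y = - p (rho M x k) h y" for x y h k l
    using assms by metis+
  show ?thesis
    unfolding delta_mu_rho_def zero_prod_def prod.inject if_length_eq_0_iff
    apply (simp add: numeral_eq_Suc all_length_Suc sum.cl_ivl_Suc sum.op_ivl_Suc
        arg_def omit_def put_def signed_rec)
    apply (intro conj_cong all_cong1)
    subgoal by (simp add: algebra_simps skew)
    subgoal by (simp add: algebra_simps skew)
    done
qed

text \<open>Yields the ternary axioms of \<open>H\<close> and of its representation. As in
  \<open>delta_psi_nu_F1\<close>, the first component carries the opposite sign.\<close>

lemma delta_psi_nu_F3:
  fixes M :: "('g, 'h) lie_pair"
    and R :: "('g, 'h, 'v::ab_group_add, 'w::ab_group_add) lie_pair_rep"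
  shows "delta_psi_nu M R 3 3 (of12 p, of03 n) = 0 \<longleftrightarrow>
   (\<forall>h k l x. psiV R h (p k l x) - psiV R k (p h l x) + psiV R l (p h k x) + beta R (n h k l) x
        = p (hbr M h k) l x - p (hbr M h l) k x + p k l (psi M h x)
          + p (hbr M k l) h x - p h l (psi M k x) + p h k (psi M l x)) \<and>
   (\<forall>h k l l'. psiW R h (n k l l') - psiW R k (n h l l') + psiW R l (n h k l') - psiW R l' (n h k l)
        = n (hbr M h k) l l' - n (hbr M h l) k l' + n (hbr M h l') k l
          + n (hbr M k l) h l' - n (hbr M k l') h l + n (hbr M l l') h k)"
  unfolding delta_psi_nu_def zero_prod_def prod.inject if_length_eq_0_iff
  apply (simp add: numeral_eq_Suc all_length_Suc sum.cl_ivl_Suc sum.op_ivl_Suc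
      arg_def omit_def put_def signed_rec)
  apply (intro conj_cong)
  subgoal
    by (rule trans[OF _ all_last_first], intro all_cong1,
        subst eq_commute[of _ 0], simp add: algebra_simps)
  subgoal by (intro all_cong1, simp add: algebra_simps)
  done

section \<open>The cocycle condition for \<open>(F_1, 0, F_3)\<close>\<close>

lemma signed_zero: "signed m 0 = 0"
  by (simp add: signed_def)

lemma delta_mu_rho_0:
  assumes "\<And>x. rhoV R x 0 = 0" "\<And>x. rhoW R x 0 = 0" "\<And>h. alpha R 0 h = 0"
  shows "delta_mu_rho M R n r 0 = 0"
  by (simp add: delta_mu_rho_def zero_prod_def assms signed_zero fun_eq_iff)

lemma delta_psi_nu_0:
  assumes "\<And>h. psiV R h 0 = 0" "\<And>h. psiW R h 0 = 0" "\<And>x. beta R 0 x = 0"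
  shows "delta_psi_nu M R n r 0 = 0"
  by (simp add: delta_psi_nu_def zero_prod_def assms signed_zero fun_eq_iff)

lemma bilin_0:
  assumes "bilin sA sB sC f"
  shows "f 0 y = 0" "f x 0 = 0"
  using assms linear_fun_0[of sA sC "\<lambda>x. f x y"] linear_fun_0[of sB sC "f x"]
  by (simp_all add: bilin_def)

lemma bilin_neg_swap:
  assumes "bilin sA sB sC f"
  shows "bilin sB sA sC (\<lambda>y x. - f x y)"
  using assms by (simp add: bilin_def linear_neg_fun)

text \<open>The two images of the zero component vanish because the structure maps of a
  representation are bilinear. The index 1 appears as \<open>Suc 0\<close>, its simplified
  form.\<close>

lemma delta_MPL_3_iff:
  assumes "matched_pair_rep sg sh sV sW M R"
  shows "delta_MPL M R 3 [F1, 0, F3] = [0, 0, 0, 0] \<longleftrightarrow>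
    delta_mu_rho M R 3 (Suc 0) F1 = 0 \<and> delta_psi_nu M R 3 (Suc 0) F1 = 0 \<and>
    delta_mu_rho M R 3 3 F3 = 0 \<and> delta_psi_nu M R 3 3 F3 = 0"
proof -
  have *: "bilin sg sV sV (rhoV R)" "bilin sg sW sW (rhoW R)" "bilin sh sV sV (psiV R)"
      "bilin sh sW sW (psiW R)" "bilin sV sh sW (alpha R)" "bilin sW sg sV (beta R)"
    using assms by (auto simp: matched_pair_rep_def lie_rep_def)
  have "delta_mu_rho M R 3 2 0 = 0" "delta_psi_nu M R 3 2 0 = 0"
    by (intro delta_mu_rho_0 delta_psi_nu_0 *[THEN bilin_0(1)] *[THEN bilin_0(2)])+
  moreover have "[1..<3 + 2] = [1, 2, 3, 4]"
    by (simp add: upt_rec)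
  ultimately show ?thesis
    by (simp add: delta_MPL_def)
qed

text \<open>\<open>Vector_Spaces.linear\<close> includes that source and target are vector spaces,
  so even the zero cochain relies on these hypotheses.\<close>

lemma zero_alt_hom:
  assumes "vector_space sg" "vector_space sh" "vector_space sV"
  shows "0 \<in> alt_hom sg sh sV p q"
  using assms
  by (simp add: alt_hom_def Vector_Spaces.linear_iff module_iff_vector_space[symmetric] module.scale_zero_right)

lemma cochains_3_iff:
  assumes "vector_space sg" "vector_space sh" "vector_space sV" "vector_space sW"
  shows "[F1, 0, F3] \<in> cochains sg sh sV sW 3 \<longleftrightarrow>
    fst F1 \<in> alt_hom sg sh sV 3 0 \<and> snd F1 \<in> alt_hom sg sh sW 2 1 \<and>
    fst F3 \<in> alt_hom sg sh sV 1 2 \<and> snd F3 \<in> alt_hom sg sh sW 0 3"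
proof -
  have "{1..3::nat} = {1, 2, 3}"
    by auto
  then show ?thesis
    using zero_alt_hom[OF assms(1,2,3)] zero_alt_hom[OF assms(1,2,4)]
    by (auto simp: cochains_def bicochains_def mem_Times_iff numeral_eq_Suc)
qed

section \<open>Matched pairs of skeletal algebras as cocycle triples\<close>

lemma skeletal_Linf_iff:
  fixes s0 :: "'k::field_char_0 \<Rightarrow> 'a::ab_group_add \<Rightarrow> 'a"
    and s1 :: "'k \<Rightarrow> 'b::ab_group_add \<Rightarrow> 'b"
  shows "skeletal_Linf s0 s1 G \<longleftrightarrow>
    br10 G = (\<lambda>v x. - br01 G x v) \<and>
    lie_algebra s0 (br00 G) \<and> lie_rep s0 s1 (br00 G) (br01 G) \<and>
    trilin s0 s0 s0 s1 (br3 G) \<and>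
    (\<forall>x y z. br3 G y x z = - br3 G x y z) \<and> (\<forall>x y z. br3 G x z y = - br3 G x y z) \<and>
    (\<forall>x y z z'.
        br01 G x (br3 G y z z') - br01 G y (br3 G x z z')
          + br01 G z (br3 G x y z') - br01 G z' (br3 G x y z)
        = br3 G (br00 G x y) z z' - br3 G (br00 G x z) y z' + br3 G (br00 G x z') y z
          + br3 G (br00 G y z) x z' - br3 G (br00 G y z') x z + br3 G (br00 G z z') x y)"
    (is "_ \<longleftrightarrow> ?skew \<and> ?lie \<and> ?rep \<and> ?rest")
\<comment> \<open>If the equation for \<open>br10\<close> fails, both sides are false. If it holds,
  bilinearity of \<open>br10\<close> follows from that of \<open>br01\<close>, and the mixed Jacobi
  identity becomes the representation law of \<open>br01\<close>.\<close>
proof (cases ?skew)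
  case True
  then have s01: "\<forall>x v. br01 G x v = - br10 G v x"
    by simp
  have b10: "bilin s1 s0 s1 (br10 G)" if "bilin s0 s1 s1 (br01 G)"
    using bilin_neg_swap[OF that] True by simp
  have jac: "(\<forall>x y v. br01 G x (br01 G y v) + br01 G y (br10 G v x) + br10 G v (br00 G x y) = 0)
      \<longleftrightarrow> (\<forall>x y v. br01 G (br00 G x y) v = br01 G x (br01 G y v) - br01 G y (br01 G x v))"
    if "bilin s0 s1 s1 (br01 G)"
  proof -
    have "br01 G y (- u) = - br01 G y u" for y u
      using linear_neg_fun
      by (metis (no_types, lifting) add_eq_0_iff bilin_0(2) bilin_def Vector_Spaces.linear_iff right_minus that)
    then show ?thesis
      by (simp add: True algebra_simps eq_commute)
  qed
  note rules = b10 jac[THEN iffD1] jac[THEN iffD2]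
    skew_iff_alternating[of s0 s0 "br00 G", THEN iffD1] skew_iff_alternating[of s0 s0 "br00 G", THEN iffD2]
  show ?thesis
    unfolding skeletal_Linf_def lie_algebra_def lie_rep_def
    by (rule iffI; elim conjE; intro conjI; (assumption | rule True s01 | (rule rules; assumption)))
next
  case False
  then have "\<not> (\<forall>x v. br01 G x v = - br10 G v x)"
    by (metis ext minus_minus)
  with False show ?thesis
    unfolding skeletal_Linf_def by blast
qed

lemma diff_diff_eq_0_iff: "a - b - c = 0 \<longleftrightarrow> c = a - b" for a b c :: "'z::ab_group_add"
  by auto

lemma skeletal_rep_iff:
  "skeletal_rep s0 s1 t0 t1 G R \<longleftrightarrow>
     lie_rep s0 t0 (br00 G) (act00 R) \<and> lie_rep s0 t1 (br00 G) (act01 R) \<and>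
     bilin s1 t0 t1 (act10 R) \<and> trilin s0 s0 t0 t1 (act3 R) \<and>
     (\<forall>x y v. act3 R x y v = - act3 R y x v) \<and>
     (\<forall>x y z v.
        act01 R x (act3 R y z v) - act01 R y (act3 R x z v) + act01 R z (act3 R x y v)
          + act10 R (br3 G x y z) v
        = act3 R (br00 G x y) z v - act3 R (br00 G x z) y v + act3 R y z (act00 R x v)
          + act3 R (br00 G y z) x v - act3 R x z (act00 R y v) + act3 R x y (act00 R z v))"
  unfolding skeletal_rep_def lie_rep_def diff_diff_eq_0_iff
  by (rule iffI; elim conjE; intro conjI; assumption)

lemma to_triple_eq:
  "to_triple (G, H, R, P) =
     (\<lparr> gbr = br00 G, hbr = br00 H, rho = act00 R, psi = act00 P \<rparr>,
      \<lparr> rhoV = br01 G, rhoW = act01 R, psiV = act01 P, psiW = br01 H,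
        alpha = act10 R, beta = act10 P \<rparr>,
      [(of30 (br3 G), of21 (act3 R)), 0, (of12 (act3 P), of03 (br3 H))])"
  by (simp add: to_triple_def of30_def of21_def of12_def of03_def)

text \<open>The two equations for \<open>br10\<close> restore what \<open>to_triple\<close> forgets.
  After rewriting with \<open>iffs\<close> and \<open>components\<close>, both sides are built from
  the same identities, so propositional reasoning finishes.\<close>

lemma skeletal_matched_pair_iff:
  fixes sg0 :: "'k::field_char_0 \<Rightarrow> 'a::ab_group_add \<Rightarrow> 'a"
    and sg1 :: "'k \<Rightarrow> 'b::ab_group_add \<Rightarrow> 'b"
    and sh0 :: "'k \<Rightarrow> 'c::ab_group_add \<Rightarrow> 'c"
    and sh1 :: "'k \<Rightarrow> 'd::ab_group_add \<Rightarrow> 'd"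
  assumes "vector_space sg0" "vector_space sg1" "vector_space sh0" "vector_space sh1"
  shows "skeletal_matched_pair sg0 sg1 sh0 sh1 G H R P \<longleftrightarrow>
    br10 G = (\<lambda>v x. - br01 G x v) \<and> br10 H = (\<lambda>w h. - br01 H h w) \<and>
    to_triple (G, H, R, P) \<in> cocycle_triples sg0 sh0 sg1 sh1"
    (is "_ \<longleftrightarrow> ?sG \<and> ?sH \<and> _")
proof (cases "?sG \<and> ?sH")
  case True
  then have sG: "br10 G = (\<lambda>v x. - br01 G x v)" and sH: "br10 H = (\<lambda>w h. - br01 H h w)"
    by blast+
  let ?M = "\<lparr> gbr = br00 G, hbr = br00 H, rho = act00 R, psi = act00 P \<rparr>"
  let ?R = "\<lparr> rhoV = br01 G, rhoW = act01 R, psiV = act01 P, psiW = br01 H,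
      alpha = act10 R, beta = act10 P \<rparr>"
  let ?F1 = "(of30 (br3 G), of21 (act3 R))" and ?F3 = "(of12 (act3 P), of03 (br3 H))"
  have triple: "to_triple (G, H, R, P) \<in> cocycle_triples sg0 sh0 sg1 sh1 \<longleftrightarrow>
     lie_matched_pair sg0 sh0 ?M \<and> matched_pair_rep sg0 sh0 sg1 sh1 ?M ?R \<and>
     [?F1, 0, ?F3] \<in> cochains sg0 sh0 sg1 sh1 3 \<and> delta_MPL ?M ?R 3 [?F1, 0, ?F3] = [0, 0, 0, 0]"
    unfolding to_triple_eq cocycle_triples_def by blast
  note iffs = skeletal_Linf_iff skeletal_rep_iff cochains_3_iff[OF assms(1,3,2,4)] fst_conv snd_conv
    of30_alt_hom_iff of21_alt_hom_iff of12_alt_hom_iff of03_alt_hom_iff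
    lie_pair.select_convs lie_pair_rep.select_convs
  \<comment> \<open>The last two equivalences are conditional on skew-symmetry, which is therefore
    extracted before the cocycle condition is translated in either direction.\<close>
  note components =
    delta_mu_rho_F1[of ?M ?R "br3 G" "act3 R"] delta_psi_nu_F3[of ?M ?R "act3 P" "br3 H"]
    delta_psi_nu_F1[of "br3 G" "act3 R" ?M ?R] delta_mu_rho_F3[of "br3 H" "act3 P" ?M ?R]
  show ?thesis
  proof
    assume mp: "skeletal_matched_pair sg0 sg1 sh0 sh1 G H R P"
    note mp' = mp[unfolded skeletal_matched_pair_def iffs sG sH]
    have M: "lie_matched_pair sg0 sh0 ?M"
      using mp' unfolding lie_matched_pair_def iffs by satx
    have R: "matched_pair_rep sg0 sh0 sg1 sh1 ?M ?R"
      using mp' unfolding matched_pair_rep_def iffs by satx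
    have C: "[?F1, 0, ?F3] \<in> cochains sg0 sh0 sg1 sh1 3"
      using mp' unfolding iffs by satx
    have skew: "\<forall>x y z. br3 G y x z = - br3 G x y z" "\<forall>x y z. br3 G x z y = - br3 G x y z"
      "\<forall>x y z. br3 H y x z = - br3 H x y z" "\<forall>x y z. br3 H x z y = - br3 H x y z"
      "\<forall>x y z. act3 R x y z = - act3 R y x z" "\<forall>x y z. act3 P x y z = - act3 P y x z"
      using mp' by satx+
    have "delta_MPL ?M ?R 3 [?F1, 0, ?F3] = [0, 0, 0, 0]"
      using mp'
      unfolding delta_MPL_3_iff[OF R] components(1,2) components(3)[OF skew(1,2,5)]
        components(4)[OF skew(3,4,6)] iffs by satx
    with M R C show "?sG \<and> ?sH \<and> to_triple (G, H, R, P) \<in> cocycle_triples sg0 sh0 sg1 sh1"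
      using sG sH triple by blast
  next
    assume "?sG \<and> ?sH \<and> to_triple (G, H, R, P) \<in> cocycle_triples sg0 sh0 sg1 sh1"
    then have M: "lie_matched_pair sg0 sh0 ?M" and R: "matched_pair_rep sg0 sh0 sg1 sh1 ?M ?R"
      and C: "[?F1, 0, ?F3] \<in> cochains sg0 sh0 sg1 sh1 3"
      and D: "delta_MPL ?M ?R 3 [?F1, 0, ?F3] = [0, 0, 0, 0]"
      using triple by blast+
    note C' = C[unfolded iffs]
    have skew: "\<forall>x y z. br3 G y x z = - br3 G x y z" "\<forall>x y z. br3 G x z y = - br3 G x y z"
      "\<forall>x y z. br3 H y x z = - br3 H x y z" "\<forall>x y z. br3 H x z y = - br3 H x y z"
      "\<forall>x y z. act3 R x y z = - act3 R y x z" "\<forall>x y z. act3 P x y z = - act3 P y x z"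
      using C' by satx+
    show "skeletal_matched_pair sg0 sg1 sh0 sh1 G H R P"
      using M[unfolded lie_matched_pair_def iffs] R[unfolded matched_pair_rep_def iffs] C'
        D[unfolded delta_MPL_3_iff[OF R] components(1,2) components(3)[OF skew(1,2,5)]
          components(4)[OF skew(3,4,6)] iffs]
      unfolding skeletal_matched_pair_def iffs sG sH
      \<comment> \<open>Rewriting by \<open>sG\<close> and \<open>sH\<close> turns the equations for
        \<open>br10\<close> into reflexive ones, which \<open>satx\<close> treats as opaque atoms
        and must be given.\<close>
      using refl[of "\<lambda>v x. - br01 G x v"] refl[of "\<lambda>w h. - br01 H h w"] by satx
  qed
next
  case False
  then show ?thesis
    unfolding skeletal_matched_pair_def skeletal_Linf_iff by blast
qed

section \<open>Surjectivity and injectivity of \<open>to_triple\<close>\<close>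

lemma to_triple_surj:
  assumes "vector_space sg0" "vector_space sg1" "vector_space sh0" "vector_space sh1"
    and "T \<in> cocycle_triples sg0 sh0 sg1 sh1"
  shows "\<exists>G H R P. to_triple (G, H, R, P) = T \<and>
    br10 G = (\<lambda>v x. - br01 G x v) \<and> br10 H = (\<lambda>w h. - br01 H h w)"
proof -
  obtain M R F1 F3 where T: "T = (M, R, [F1, 0, F3])"
    and C: "[F1, 0, F3] \<in> cochains sg0 sh0 sg1 sh1 3"
    using assms(5) unfolding cocycle_triples_def by blast
  \<comment> \<open>All fields are read off from the triple except \<open>br10\<close>, which
    skew-symmetry forces to be minus the action.\<close>
  let ?G = "\<lparr> br00 = gbr M, br01 = rhoV R, br10 = \<lambda>v x. - rhoV R x v,
      br3 = \<lambda>x y z. fst F1 [x, y, z] [] \<rparr>"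
  let ?H = "\<lparr> br00 = hbr M, br01 = psiW R, br10 = \<lambda>w h. - psiW R h w,
      br3 = \<lambda>h k l. snd F3 [] [h, k, l] \<rparr>"
  let ?R = "\<lparr> act00 = rho M, act01 = rhoW R, act10 = alpha R,
      act3 = \<lambda>x y h. snd F1 [x, y] [h] \<rparr>"
  let ?P = "\<lparr> act00 = psi M, act01 = psiV R, act10 = beta R,
      act3 = \<lambda>h k x. fst F3 [x] [h, k] \<rparr>"
  have "fst F1 \<in> alt_hom sg0 sh0 sg1 3 0" "snd F1 \<in> alt_hom sg0 sh0 sh1 2 1"
    "fst F3 \<in> alt_hom sg0 sh0 sg1 1 2" "snd F3 \<in> alt_hom sg0 sh0 sh1 0 3"
    using C cochains_3_iff[OF assms(1,3,2,4)] by blast+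
  then have "of30 (br3 ?G) = fst F1" "of21 (act3 ?R) = snd F1"
    "of12 (act3 ?P) = fst F3" "of03 (br3 ?H) = snd F3"
    unfolding skel_Linf.select_convs skel_act.select_convs
    by (intro encode_eqI; auto simp: alt_hom_def)+
  then have "to_triple (?G, ?H, ?R, ?P) = T"
    by (simp add: to_triple_eq T)
  moreover have "br10 ?G = (\<lambda>v x. - br01 ?G x v)" "br10 ?H = (\<lambda>w h. - br01 ?H h w)"
    by simp_all
  ultimately show ?thesis
    by blast
qed

lemma encode_inject:
  "(of30 f :: 'g list \<Rightarrow> 'h list \<Rightarrow> 'v::zero) = of30 f' \<Longrightarrow> f = f'"
  "(of21 r :: 'g list \<Rightarrow> 'h list \<Rightarrow> 'v::zero) = of21 r' \<Longrightarrow> r = r'"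
  "(of12 p :: 'g list \<Rightarrow> 'h list \<Rightarrow> 'v::zero) = of12 p' \<Longrightarrow> p = p'"
  "(of03 n :: 'g list \<Rightarrow> 'h list \<Rightarrow> 'v::zero) = of03 n' \<Longrightarrow> n = n'"
  by (intro ext; metis encode_simps)+

text \<open>The ternary operations are recovered from their encodings, and the triple stores every
  binary operation except \<open>br10\<close>, which the hypotheses express through
  \<open>br01\<close>.\<close>

lemma to_triple_inject:
  assumes "to_triple (G, H, R, P) = to_triple (G', H', R', P')"
    and "br10 G = (\<lambda>v x. - br01 G x v)" "br10 H = (\<lambda>w h. - br01 H h w)"
    and "br10 G' = (\<lambda>v x. - br01 G' x v)" "br10 H' = (\<lambda>w h. - br01 H' h w)"
  shows "(G, H, R, P) = (G', H', R', P')"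
  using assms
  by (auto simp: to_triple_eq dest!: encode_inject
      intro!: skel_Linf.equality skel_act.equality)

theorem theorem7p3:
  fixes sg0 :: "'k::field_char_0 \<Rightarrow> 'a::ab_group_add \<Rightarrow> 'a"
    and sg1 :: "'k \<Rightarrow> 'b::ab_group_add \<Rightarrow> 'b"
    and sh0 :: "'k \<Rightarrow> 'c::ab_group_add \<Rightarrow> 'c"
    and sh1 :: "'k \<Rightarrow> 'd::ab_group_add \<Rightarrow> 'd"
  assumes "vector_space sg0" and "vector_space sg1"
    and "vector_space sh0" and "vector_space sh1"
  shows "bij_betw to_triple
           (skeletal_matched_pairs sg0 sg1 sh0 sh1)
           (cocycle_triples sg0 sh0 sg1 sh1)"
proof -
  \<comment> \<open>The domain is thereby the preimage of \<open>cocycle_triples\<close>, cut down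
    by the two equations for \<open>br10\<close>. These are exactly the premises of
    \<open>to_triple_inject\<close> and the extra conclusions of
    \<open>to_triple_surj\<close>.\<close>
  note iff = skeletal_matched_pair_iff[OF assms]
  show ?thesis
    unfolding bij_betw_def
  proof (intro conjI inj_onI subset_antisym subsetI)
    fix X Y
    assume "X \<in> skeletal_matched_pairs sg0 sg1 sh0 sh1" "Y \<in> skeletal_matched_pairs sg0 sg1 sh0 sh1"
      and "to_triple X = to_triple Y"
    then show "X = Y"
      unfolding skeletal_matched_pairs_def iff by (cases X; cases Y) (auto dest: to_triple_inject)
  next
    fix T
    assume "T \<in> to_triple ` skeletal_matched_pairs sg0 sg1 sh0 sh1"
    then show "T \<in> cocycle_triples sg0 sh0 sg1 sh1"
      unfolding skeletal_matched_pairs_def iff by blast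
  next
    fix T
    assume "T \<in> cocycle_triples sg0 sh0 sg1 sh1"
    with to_triple_surj[OF assms this]
    show "T \<in> to_triple ` skeletal_matched_pairs sg0 sg1 sh0 sh1"
      unfolding skeletal_matched_pairs_def iff by (fastforce intro!: image_eqI)
  qed
qed

end
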